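(* Let $K$ be a field. The variety $\mathcal{A}_K$ of all (not necessarily associative) $K$-algebras is MLM. That is: for every field extension $K\subseteq F$, every $F$-algebra $A$ and every finite subset $Y=\{y_1,\dots,y_n\}\subseteq A$ of at least two elements such that the $K$-subalgebra of $A$ generated by $Y$ is the free nonassociative $K$-algebra with set of free generators $Y$, the $F$-subalgebra of $A$ generated by $Y$ is the free nonassociative $F$-algebra with set of free generators $Y$.
   Context: Algebras over a field are vector spaces with a bilinear product; they are not assumed to be associative or to have a unit. The free nonassociative $K$-algebra $K\{Y\}$ on a set $Y$ is characterized by the property that every map from $Y$ to a $K$-algebra extends uniquely to a $K$-algebra homomorphism; it has as $K$-basis the nonassociative words in $Y$. *)

theory Defs
  imports Complex_Main "HOL-Library.Poly_Mapping"
begin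

locale nonassoc_algebra = vector_space scale
  for scale :: "'k::field \<Rightarrow> 'a::ab_group_add \<Rightarrow> 'a" +
  fixes mult :: "'a \<Rightarrow> 'a \<Rightarrow> 'a"
  assumes linear_mult_left: "Vector_Spaces.linear scale scale (\<lambda>x. mult x y)"
    and linear_mult_right: "Vector_Spaces.linear scale scale (\<lambda>y. mult x y)"

definition subalgebra ::
    "('k::field \<Rightarrow> 'a::ab_group_add \<Rightarrow> 'a) \<Rightarrow> ('a \<Rightarrow> 'a \<Rightarrow> 'a) \<Rightarrow> 'a set \<Rightarrow> bool"
  where "subalgebra scale mult S \<longleftrightarrow>
    module.subspace scale S \<and> (\<forall>x\<in>S. \<forall>y\<in>S. mult x y \<in> S)"

definition generated_subalgebra ::
    "('k::field \<Rightarrow> 'a::ab_group_add \<Rightarrow> 'a) \<Rightarrow> ('a \<Rightarrow> 'a \<Rightarrow> 'a) \<Rightarrow> 'a set \<Rightarrow> 'a set"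
  where "generated_subalgebra scale mult Y = subalgebra scale mult hull Y"

text \<open>Homomorphisms are functions on the ambient type; only the values on the
  subalgebra \<open>S\<close> that serves as their domain matter.\<close>

definition algebra_hom_on ::
    "'a set \<Rightarrow> ('k::field \<Rightarrow> 'a::ab_group_add \<Rightarrow> 'a) \<Rightarrow> ('a \<Rightarrow> 'a \<Rightarrow> 'a) \<Rightarrow>
     ('k \<Rightarrow> 'b::ab_group_add \<Rightarrow> 'b) \<Rightarrow> ('b \<Rightarrow> 'b \<Rightarrow> 'b) \<Rightarrow> ('a \<Rightarrow> 'b) \<Rightarrow> bool"
  where "algebra_hom_on S scale mult scale' mult' \<phi> \<longleftrightarrow>
    (\<forall>x\<in>S. \<forall>y\<in>S. \<phi> (x + y) = \<phi> x + \<phi> y) \<and>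
    (\<forall>c. \<forall>x\<in>S. \<phi> (scale c x) = scale' c (\<phi> x)) \<and>
    (\<forall>x\<in>S. \<forall>y\<in>S. \<phi> (mult x y) = mult' (\<phi> x) (\<phi> y))"

datatype (letters: 'y) word = Letter 'y | Juxt "'y word" "'y word"

text \<open>The type \<open>'y word \<Rightarrow>\<^sub>0 'k\<close> of finitely supported functions is the vector space with
  basis the words in all of \<open>'y\<close>; \<open>K{Y}\<close> is the span \<open>free_algebra Y\<close> of the words in \<open>Y\<close>.
  The product is the bilinear extension of juxtaposition \<open>(u, v) \<mapsto> (uv)\<close> of words. Since every
  word that is not a letter is \<open>Juxt u v\<close> for unique \<open>u\<close> and \<open>v\<close>, a single product of
  coefficients contributes to each coefficient.\<close>

definition free_scale :: "'k::field \<Rightarrow> ('y word \<Rightarrow>\<^sub>0 'k) \<Rightarrow> ('y word \<Rightarrow>\<^sub>0 'k)"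
  where "free_scale c p = Poly_Mapping.map ((*) c) p"

lift_definition free_mult ::
    "('y word \<Rightarrow>\<^sub>0 'k::field) \<Rightarrow> ('y word \<Rightarrow>\<^sub>0 'k) \<Rightarrow> ('y word \<Rightarrow>\<^sub>0 'k)"
  is "\<lambda>p q w. case w of Letter _ \<Rightarrow> 0 | Juxt u v \<Rightarrow> p u * q v"
proof -
  fix p q :: "'y word \<Rightarrow> 'k"
  assume fin: "finite {x. p x \<noteq> 0}" "finite {x. q x \<noteq> 0}"
  have "{w. (case w of Letter _ \<Rightarrow> 0 | Juxt u v \<Rightarrow> p u * q v) \<noteq> 0}
      \<subseteq> case_prod Juxt ` ({x. p x \<noteq> 0} \<times> {x. q x \<noteq> 0})"
  proof
    fix w assume "w \<in> {w. (case w of Letter _ \<Rightarrow> 0 | Juxt u v \<Rightarrow> p u * q v) \<noteq> 0}"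
    then show "w \<in> case_prod Juxt ` ({x. p x \<noteq> 0} \<times> {x. q x \<noteq> 0})"
      by (cases w) force+
  qed
  then show "finite {w. (case w of Letter _ \<Rightarrow> 0 | Juxt u v \<Rightarrow> p u * q v) \<noteq> 0}"
    using fin finite_subset by blast
qed

definition free_gen :: "'y \<Rightarrow> ('y word \<Rightarrow>\<^sub>0 'k::field)"
  where "free_gen y = Poly_Mapping.single (Letter y) 1"

definition free_algebra :: "'y set \<Rightarrow> ('y word \<Rightarrow>\<^sub>0 'k::field) set"
  where "free_algebra Y = {p. \<forall>w\<in>Poly_Mapping.keys p. letters w \<subseteq> Y}"

text \<open>The subalgebra generated by \<open>Y\<close> is the free algebra with set of free generators \<open>Y\<close>:
  it is isomorphic to \<open>K{Y}\<close> by an isomorphism that is the identity on \<open>Y\<close>. The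
  theorems \<open>freely_generates_universal\<close>, \<open>algebra_hom_on_unique\<close> and
  \<open>universal_imp_freely_generates\<close> below relate this to the universal property.\<close>

definition freely_generates ::
    "('k::field \<Rightarrow> 'a::ab_group_add \<Rightarrow> 'a) \<Rightarrow> ('a \<Rightarrow> 'a \<Rightarrow> 'a) \<Rightarrow> 'a set \<Rightarrow> bool"
  where "freely_generates scale mult Y \<longleftrightarrow>
    (\<exists>\<phi>. algebra_hom_on (free_algebra Y) free_scale free_mult scale mult \<phi> \<and>
         bij_betw \<phi> (free_algebra Y) (generated_subalgebra scale mult Y) \<and>
         (\<forall>y\<in>Y. \<phi> (free_gen y) = y))"

text \<open>The extension is given by its inclusion map, which is injective because \<open>\<iota> 1 = 1\<close>. An algebra
  with scalar multiplication \<open>scale\<close> over the larger field is an algebra over the smaller one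
  with scalar multiplication \<open>\<lambda>c. scale (\<iota> c)\<close>.\<close>

locale field_extension =
  fixes \<iota> :: "'k::field \<Rightarrow> 'f::field"
  assumes embed_one: "\<iota> 1 = 1"
    and embed_add: "\<iota> (x + y) = \<iota> x + \<iota> y"
    and embed_mult: "\<iota> (x * y) = \<iota> x * \<iota> y"

lemma lookup_free_scale [simp]:
  "Poly_Mapping.lookup (free_scale c p) w = c * Poly_Mapping.lookup p w"
  by (simp add: free_scale_def Poly_Mapping.map.rep_eq when_def)

lemma lookup_free_mult [simp]:
  "Poly_Mapping.lookup (free_mult p q) w = (case w of Letter _ \<Rightarrow> 0
    | Juxt u v \<Rightarrow> Poly_Mapping.lookup p u * Poly_Mapping.lookup q v)"
  by (simp add: free_mult.rep_eq)

interpretation free: nonassoc_algebra free_scale free_mult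
proof -
  have vs: "vector_space (free_scale :: 'k::field \<Rightarrow> ('y word \<Rightarrow>\<^sub>0 'k) \<Rightarrow> _)"
    by standard (auto intro!: poly_mapping_eqI simp: lookup_add algebra_simps)
  then show "nonassoc_algebra (free_scale :: 'k::field \<Rightarrow> ('y word \<Rightarrow>\<^sub>0 'k) \<Rightarrow> _) free_mult"
    unfolding nonassoc_algebra_def nonassoc_algebra_axioms_def Vector_Spaces.linear_iff
    by (auto intro!: poly_mapping_eqI simp: lookup_add algebra_simps split: word.splits)
qed

context nonassoc_algebra
begin

lemma mult_simps:
  "mult (x + x') y = mult x y + mult x' y" "mult (scale c x) y = scale c (mult x y)"
  "mult x (y + y') = mult x y + mult x y'" "mult x (scale c y) = scale c (mult x y)"
  using linear_mult_left linear_mult_right unfolding Vector_Spaces.linear_iff by auto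

lemma mult_sum_left: "mult (\<Sum>i\<in>I. f i) y = (\<Sum>i\<in>I. mult (f i) y)"
  using module_hom.sum[OF linear_mult_left[unfolded Vector_Spaces.linear_iff_module_hom]] .

lemma mult_sum_right: "mult x (\<Sum>i\<in>I. f i) = (\<Sum>i\<in>I. mult x (f i))"
  using module_hom.sum[OF linear_mult_right[unfolded Vector_Spaces.linear_iff_module_hom]] .

lemma subalgebra_iff: "subalgebra scale mult S \<longleftrightarrow> 0 \<in> S \<and> (\<forall>x\<in>S. \<forall>y\<in>S. x + y \<in> S) \<and>
   (\<forall>c. \<forall>x\<in>S. scale c x \<in> S) \<and> (\<forall>x\<in>S. \<forall>y\<in>S. mult x y \<in> S)"
  unfolding subalgebra_def subspace_def by blast

lemma subalgebra_generated: "subalgebra scale mult (generated_subalgebra scale mult Y)"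
  unfolding generated_subalgebra_def by (rule hull_in) (auto simp: subalgebra_iff)

lemma generated_subalgebra_superset: "Y \<subseteq> generated_subalgebra scale mult Y"
  unfolding generated_subalgebra_def by (rule hull_subset)

lemma generated_subalgebra_minimal:
  "Y \<subseteq> S \<Longrightarrow> subalgebra scale mult S \<Longrightarrow> generated_subalgebra scale mult Y \<subseteq> S"
  unfolding generated_subalgebra_def by (rule hull_minimal)

fun eval_word :: "('y \<Rightarrow> 'a) \<Rightarrow> 'y word \<Rightarrow> 'a"
  where "eval_word f (Letter y) = f y"
  | "eval_word f (Juxt u v) = mult (eval_word f u) (eval_word f v)"

definition free_lift :: "('y \<Rightarrow> 'a) \<Rightarrow> ('y word \<Rightarrow>\<^sub>0 'k) \<Rightarrow> 'a"
  where "free_lift f p = (\<Sum>w\<in>Poly_Mapping.keys p. scale (Poly_Mapping.lookup p w) (eval_word f w))"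

lemma free_lift_superset:
  assumes "finite W" "Poly_Mapping.keys p \<subseteq> W"
  shows "free_lift f p = (\<Sum>w\<in>W. scale (Poly_Mapping.lookup p w) (eval_word f w))"
  unfolding free_lift_def
  by (rule sum.mono_neutral_left) (use assms in \<open>auto simp: in_keys_iff\<close>)

lemma free_lift_add: "free_lift f (p + q) = free_lift f p + free_lift f q"
proof -
  let ?W = "Poly_Mapping.keys p \<union> Poly_Mapping.keys q"
  have "Poly_Mapping.keys (p + q) \<subseteq> ?W"
    by (rule keys_add)
  then show ?thesis
    by (simp add: free_lift_superset[of ?W] lookup_add scale_left_distrib sum.distrib)
qed

lemma free_lift_scale: "free_lift f (free_scale c p) = scale c (free_lift f p)"
proof -
  have "Poly_Mapping.keys (free_scale c p) \<subseteq> Poly_Mapping.keys p"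
    by (auto simp: in_keys_iff)
  then show ?thesis
    by (simp add: free_lift_superset[of "Poly_Mapping.keys p"] scale_sum_right)
qed

lemma free_lift_mult: "free_lift f (free_mult p q) = mult (free_lift f p) (free_lift f q)"
proof -
  let ?W = "case_prod Juxt ` (Poly_Mapping.keys p \<times> Poly_Mapping.keys q)"
  have "Poly_Mapping.keys (free_mult p q) \<subseteq> ?W"
  proof
    fix w assume "w \<in> Poly_Mapping.keys (free_mult p q)"
    then show "w \<in> ?W"
      by (cases w) (force simp: in_keys_iff)+
  qed
  then have "free_lift f (free_mult p q)
      = (\<Sum>w\<in>?W. scale (Poly_Mapping.lookup (free_mult p q) w) (eval_word f w))"
    by (rule free_lift_superset[rotated]) simp
  also have "\<dots> = (\<Sum>(u, v)\<in>Poly_Mapping.keys p \<times> Poly_Mapping.keys q.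
      scale (Poly_Mapping.lookup p u * Poly_Mapping.lookup q v)
        (mult (eval_word f u) (eval_word f v)))"
    by (subst sum.reindex) (auto simp: inj_on_def intro!: sum.cong)
  also have "\<dots> = (\<Sum>u\<in>Poly_Mapping.keys p. \<Sum>v\<in>Poly_Mapping.keys q.
      scale (Poly_Mapping.lookup p u * Poly_Mapping.lookup q v)
        (mult (eval_word f u) (eval_word f v)))"
    by (simp add: sum.cartesian_product)
  also have "\<dots> = mult (free_lift f p) (free_lift f q)"
    unfolding free_lift_def mult_sum_left
    by (simp add: mult_sum_right mult_simps scale_sum_right mult.commute)
  finally show ?thesis .
qed

lemma free_lift_hom: "algebra_hom_on S free_scale free_mult scale mult (free_lift f)"
  by (simp add: algebra_hom_on_def free_lift_add free_lift_scale free_lift_mult)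

lemma free_lift_gen [simp]: "free_lift f (free_gen y) = f y"
  by (simp add: free_lift_def free_gen_def)

end

lemma algebra_hom_on_unique:
  assumes "nonassoc_algebra s m" "nonassoc_algebra s' m'"
    and "algebra_hom_on (generated_subalgebra s m Y) s m s' m' \<phi>"
    and "algebra_hom_on (generated_subalgebra s m Y) s m s' m' \<psi>"
    and "\<And>y. y \<in> Y \<Longrightarrow> \<phi> y = \<psi> y" and "x \<in> generated_subalgebra s m Y"
  shows "\<phi> x = \<psi> x"
proof -
  interpret A: nonassoc_algebra s m by fact
  interpret B: nonassoc_algebra s' m' by fact
  let ?G = "generated_subalgebra s m Y"
  have G: "subalgebra s m ?G" by (rule A.subalgebra_generated)
  then have z: "0 \<in> ?G" by (simp add: A.subalgebra_iff)
  have "\<phi> 0 = 0" "\<psi> 0 = 0"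
    using assms(3,4) z unfolding algebra_hom_on_def
    by (metis A.scale_zero_left B.scale_zero_left)+
  then have "subalgebra s m {x\<in>?G. \<phi> x = \<psi> x}"
    using assms(3,4) G unfolding A.subalgebra_iff algebra_hom_on_def by auto
  then have "?G \<subseteq> {x\<in>?G. \<phi> x = \<psi> x}"
    using A.generated_subalgebra_superset assms(5)
    by (intro A.generated_subalgebra_minimal) auto
  then show ?thesis using assms(6) by blast
qed

lemma algebra_hom_image_generated:
  assumes "nonassoc_algebra s m" "nonassoc_algebra s' m'"
    and hom: "algebra_hom_on (generated_subalgebra s m Y) s m s' m' \<phi>"
  shows "\<phi> ` generated_subalgebra s m Y = generated_subalgebra s' m' (\<phi> ` Y)"
proof -
  interpret A: nonassoc_algebra s m by fact
  interpret B: nonassoc_algebra s' m' by fact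
  let ?G = "generated_subalgebra s m Y" and ?H = "generated_subalgebra s' m' (\<phi> ` Y)"
  have G: "subalgebra s m ?G" by (rule A.subalgebra_generated)
  have H: "subalgebra s' m' ?H" by (rule B.subalgebra_generated)
  have z: "0 \<in> ?G" using G by (simp add: A.subalgebra_iff)
  then have z': "\<phi> 0 = 0"
    using hom unfolding algebra_hom_on_def by (metis A.scale_zero_left B.scale_zero_left)
  have "subalgebra s m {x\<in>?G. \<phi> x \<in> ?H}"
    using hom G H z z' unfolding A.subalgebra_iff B.subalgebra_iff algebra_hom_on_def by simp
  moreover have "Y \<subseteq> {x\<in>?G. \<phi> x \<in> ?H}"
    using A.generated_subalgebra_superset B.generated_subalgebra_superset by blast
  ultimately have "?G \<subseteq> {x\<in>?G. \<phi> x \<in> ?H}"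
    by (intro A.generated_subalgebra_minimal)
  moreover have "subalgebra s' m' (\<phi> ` ?G)"
    unfolding B.subalgebra_iff
  proof (intro conjI ballI allI)
    show "0 \<in> \<phi> ` ?G" using z z' by (metis imageI)
    fix x y c assume "x \<in> \<phi> ` ?G"
    then obtain a where a: "a \<in> ?G" "x = \<phi> a" by blast
    then show "s' c x \<in> \<phi> ` ?G"
      using hom G unfolding algebra_hom_on_def A.subalgebra_iff by (metis imageI)
    assume "y \<in> \<phi> ` ?G"
    then obtain b where b: "b \<in> ?G" "y = \<phi> b" by blast
    show "x + y \<in> \<phi> ` ?G" "m' x y \<in> \<phi> ` ?G"
      using a b hom G unfolding algebra_hom_on_def A.subalgebra_iff by (metis imageI)+
  qed
  then have "?H \<subseteq> \<phi> ` ?G"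
    using A.generated_subalgebra_superset by (intro B.generated_subalgebra_minimal) auto
  ultimately show ?thesis by blast
qed

lemma free_algebra_eq_generated:
  "(free_algebra Y :: ('y word \<Rightarrow>\<^sub>0 'k::field) set)
    = generated_subalgebra free_scale free_mult (free_gen ` Y)"
proof
  let ?H = "generated_subalgebra free_scale free_mult (free_gen ` Y) :: ('y word \<Rightarrow>\<^sub>0 'k) set"
  have sub: "subalgebra free_scale free_mult (free_algebra Y :: ('y word \<Rightarrow>\<^sub>0 'k) set)"
    unfolding free.subalgebra_iff
  proof (intro conjI ballI allI)
    fix p q :: "'y word \<Rightarrow>\<^sub>0 'k" and c
    assume p: "p \<in> free_algebra Y"
    then show "free_scale c p \<in> free_algebra Y"
      by (simp add: free_algebra_def in_keys_iff)
    assume q: "q \<in> free_algebra Y"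
    show "p + q \<in> free_algebra Y"
      using p q keys_add[of p q] unfolding free_algebra_def by blast
    have "letters w \<subseteq> Y" if "w \<in> Poly_Mapping.keys (free_mult p q)" for w
      using p q that by (cases w) (auto simp: free_algebra_def in_keys_iff)
    then show "free_mult p q \<in> free_algebra Y"
      by (simp add: free_algebra_def)
  qed (simp add: free_algebra_def)
  have "free_gen ` Y \<subseteq> (free_algebra Y :: ('y word \<Rightarrow>\<^sub>0 'k) set)"
    by (auto simp: free_algebra_def free_gen_def)
  then show "?H \<subseteq> free_algebra Y"
    using sub by (rule free.generated_subalgebra_minimal)
  have H: "subalgebra free_scale free_mult ?H" by (rule free.subalgebra_generated)
  have single: "letters w \<subseteq> Y \<Longrightarrow> Poly_Mapping.single w 1 \<in> ?H" for w :: "'y word"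
  proof (induction w)
    case (Letter y)
    then show ?case
      using subsetD[OF free.generated_subalgebra_superset, of "free_gen y" "free_gen ` Y"]
      by (simp add: free_gen_def)
  next
    case (Juxt u v)
    have "Poly_Mapping.single (Juxt u v) (1::'k)
        = free_mult (Poly_Mapping.single u 1) (Poly_Mapping.single v 1)"
      by (rule poly_mapping_eqI) (auto simp: lookup_single when_def split: word.splits)
    then show ?case using Juxt H unfolding free.subalgebra_iff by auto
  qed
  show "free_algebra Y \<subseteq> ?H"
  proof
    fix p :: "'y word \<Rightarrow>\<^sub>0 'k" assume p: "p \<in> free_algebra Y"
    have "p = (\<Sum>w\<in>Poly_Mapping.keys p.
        free_scale (Poly_Mapping.lookup p w) (Poly_Mapping.single w 1))"
      by (rule poly_mapping_eqI)
        (simp add: lookup_sum lookup_single when_def if_distrib in_keys_iff cong: if_cong)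
    moreover have "free.subspace ?H" using H by (simp add: subalgebra_def)
    then have "(\<Sum>w\<in>Poly_Mapping.keys p.
        free_scale (Poly_Mapping.lookup p w) (Poly_Mapping.single w 1)) \<in> ?H"
      using p single
      by (intro free.subspace_sum free.subspace_scale) (auto simp: free_algebra_def)
    ultimately show "p \<in> ?H" by simp
  qed
qed

theorem freely_generates_universal:
  fixes s :: "'k::field \<Rightarrow> 'a::ab_group_add \<Rightarrow> 'a" and s' :: "'k \<Rightarrow> 'b::ab_group_add \<Rightarrow> 'b"
  assumes A: "nonassoc_algebra s m" and B: "nonassoc_algebra s' m'"
    and free: "freely_generates s m Y"
  shows "\<exists>\<psi>. algebra_hom_on (generated_subalgebra s m Y) s m s' m' \<psi> \<and> (\<forall>y\<in>Y. \<psi> y = f y)"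
proof -
  interpret B: nonassoc_algebra s' m' by fact
  obtain \<phi> where hom: "algebra_hom_on (free_algebra Y) free_scale free_mult s m \<phi>"
    and bij: "bij_betw \<phi> (free_algebra Y) (generated_subalgebra s m Y)"
    and gen: "\<And>y. y \<in> Y \<Longrightarrow> \<phi> (free_gen y) = y"
    using free unfolding freely_generates_def by blast
  let ?g = "inv_into (free_algebra Y) \<phi>"
  have S: "subalgebra free_scale free_mult (free_algebra Y :: ('a word \<Rightarrow>\<^sub>0 'k) set)"
    unfolding free_algebra_eq_generated by (rule free.subalgebra_generated)
  have inj: "inj_on \<phi> (free_algebra Y)" using bij by (simp add: bij_betw_def)
  have g: "?g (\<phi> p) = p" if "p \<in> free_algebra Y" for p
    using inj that by simp
  have G: "generated_subalgebra s m Y = \<phi> ` free_algebra Y" using bij by (simp add: bij_betw_def)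
  have "algebra_hom_on (generated_subalgebra s m Y) s m s' m' (B.free_lift f \<circ> ?g)"
    unfolding algebra_hom_on_def G ball_simps
  proof (intro conjI ballI allI)
    fix c and p :: "'a word \<Rightarrow>\<^sub>0 'k" assume p: "p \<in> free_algebra Y"
    have "s c (\<phi> p) = \<phi> (free_scale c p)" using hom p by (simp add: algebra_hom_on_def)
    then show "(B.free_lift f \<circ> ?g) (s c (\<phi> p)) = s' c ((B.free_lift f \<circ> ?g) (\<phi> p))"
      using p S by (simp add: g free.subalgebra_iff B.free_lift_scale)
  next
    fix p q :: "'a word \<Rightarrow>\<^sub>0 'k" assume pq: "p \<in> free_algebra Y" "q \<in> free_algebra Y"
    have "\<phi> p + \<phi> q = \<phi> (p + q)" "m (\<phi> p) (\<phi> q) = \<phi> (free_mult p q)"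
      using hom pq by (simp_all add: algebra_hom_on_def)
    then show "(B.free_lift f \<circ> ?g) (\<phi> p + \<phi> q)
        = (B.free_lift f \<circ> ?g) (\<phi> p) + (B.free_lift f \<circ> ?g) (\<phi> q)"
      "(B.free_lift f \<circ> ?g) (m (\<phi> p) (\<phi> q))
        = m' ((B.free_lift f \<circ> ?g) (\<phi> p)) ((B.free_lift f \<circ> ?g) (\<phi> q))"
      using pq S by (simp_all add: g free.subalgebra_iff B.free_lift_add B.free_lift_mult)
  qed
  moreover have "(B.free_lift f \<circ> ?g) y = f y" if "y \<in> Y" for y
  proof -
    have "free_gen y \<in> free_algebra Y"
      using that by (auto simp: free_algebra_def free_gen_def)
    then have "?g y = free_gen y" using g gen[OF that] by metis
    then show ?thesis by simp
  qed
  ultimately show ?thesis by blast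
qed

text \<open>Conversely, the universal property with respect to the type \<open>'a word \<Rightarrow>\<^sub>0 'k\<close> already
  implies freeness; uniqueness of the extension is \<open>algebra_hom_on_unique\<close>.\<close>

theorem universal_imp_freely_generates:
  fixes s :: "'k::field \<Rightarrow> 'a::ab_group_add \<Rightarrow> 'a"
  assumes A: "nonassoc_algebra s m"
    and univ: "\<And>f :: 'a \<Rightarrow> ('a word \<Rightarrow>\<^sub>0 'k).
      \<exists>\<psi>. algebra_hom_on (generated_subalgebra s m Y) s m free_scale free_mult \<psi> \<and>
          (\<forall>y\<in>Y. \<psi> y = f y)"
  shows "freely_generates s m Y"
proof -
  interpret A: nonassoc_algebra s m by fact
  let ?F = "free_algebra Y :: ('a word \<Rightarrow>\<^sub>0 'k) set" and ?G = "generated_subalgebra s m Y"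
  let ?\<phi> = "A.free_lift (\<lambda>y. y)"
  obtain \<psi> where hom: "algebra_hom_on ?G s m free_scale free_mult \<psi>"
    and gen: "\<And>y. y \<in> Y \<Longrightarrow> \<psi> y = free_gen y"
    using univ[of free_gen] by blast
  have "?\<phi> ` ?F = ?G"
    unfolding free_algebra_eq_generated
    by (subst algebra_hom_image_generated[OF free.nonassoc_algebra_axioms A A.free_lift_hom])
      (simp add: image_image)
  then have im: "\<And>p. p \<in> ?F \<Longrightarrow> ?\<phi> p \<in> ?G" by blast
  have "algebra_hom_on ?F free_scale free_mult free_scale free_mult (\<psi> \<circ> ?\<phi>)"
    using hom im A.free_lift_hom[of ?F] unfolding algebra_hom_on_def by simp
  moreover have "algebra_hom_on ?F free_scale free_mult free_scale free_mult id"
    by (simp add: algebra_hom_on_def)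
  moreover have "(\<psi> \<circ> ?\<phi>) x = id x" if "x \<in> free_gen ` Y" for x
    using that gen by auto
  ultimately have "(\<psi> \<circ> ?\<phi>) p = id p" if "p \<in> ?F" for p
    using that algebra_hom_on_unique[OF free.nonassoc_algebra_axioms free.nonassoc_algebra_axioms,
        of "free_gen ` Y" "\<psi> \<circ> ?\<phi>" id p]
    unfolding free_algebra_eq_generated by blast
  then have "inj_on ?\<phi> ?F" by (intro inj_on_inverseI[of _ \<psi>]) simp
  then show ?thesis
    unfolding freely_generates_def bij_betw_def
    using \<open>?\<phi> ` ?F = ?G\<close> A.free_lift_hom[of ?F] by (intro exI[of _ ?\<phi>]) simp
qed

end

theory Submission
  imports Defs
begin

text \<open>Let \<open>I\<close> be the kernel of the evaluation map from \<open>F{Y}\<close> to \<open>A\<close>. The hypothesis says that \<open>I\<close>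
  contains no nonzero element of \<open>K{Y}\<close>, and \<open>I = 0\<close> has to be derived. So the theorem amounts to
  the fact that every nonzero ideal of \<open>F{Y}\<close> meets \<open>K{Y}\<close> nontrivially
  (\<open>ideal_avoiding_subfield_zero\<close>).

  The reason for this fact is that in \<open>F{Y}\<close> a product \<open>pq\<close> carries the same information as the
  tensor \<open>p \<otimes> q\<close>; hence \<open>pq = qp\<close> only if \<open>p\<close> and \<open>q\<close> are proportional
  (\<open>free_commute_proportional\<close>). Write \<open>p \<in> I\<close> as \<open>c\<^sub>1q\<^sub>1 + \<dots> + c\<^sub>nq\<^sub>n\<close> with \<open>c\<^sub>i\<close> in \<open>F\<close> and \<open>q\<^sub>i\<close> in
  \<open>K{Y}\<close>. The commutator of \<open>p\<close> and \<open>q\<^sub>1\<close> lies in \<open>I\<close>, and it is the sum of the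
  \<open>c\<^sub>i(q\<^sub>iq\<^sub>1 - q\<^sub>1q\<^sub>i)\<close> with \<open>i \<ge> 2\<close>, a sum of the same kind with one term fewer. By induction on \<open>n\<close> it
  vanishes. Therefore \<open>p\<close> is a multiple of \<open>q\<^sub>1\<close> unless \<open>q\<^sub>1 = 0\<close>, and a nonzero multiple of
  \<open>q\<^sub>1\<close> in \<open>I\<close> would put \<open>q\<^sub>1\<close> itself into \<open>I\<close>.\<close>

lemma free_commute_proportional:
  assumes comm: "free_mult p q = free_mult q p" and "q \<noteq> 0"
  obtains d where "p = free_scale d q"
proof -
  obtain v where v: "Poly_Mapping.lookup q v \<noteq> 0"
    using \<open>q \<noteq> 0\<close> by (metis poly_mapping_eqI lookup_zero)
  \<comment> \<open>The coefficients at the words \<open>uv\<close>, for a fixed \<open>v\<close> in the support of \<open>q\<close>, express \<open>p\<close> by \<open>q\<close>.\<close>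
  have "Poly_Mapping.lookup p u * Poly_Mapping.lookup q v
      = Poly_Mapping.lookup q u * Poly_Mapping.lookup p v" for u
    using arg_cong[OF comm, of "\<lambda>r. Poly_Mapping.lookup r (Juxt u v)"] by simp
  then have "p = free_scale (Poly_Mapping.lookup p v / Poly_Mapping.lookup q v) q"
    using v by (intro poly_mapping_eqI) (simp add: field_simps)
  then show thesis by (rule that)
qed

lemma subalgebra_free_algebra: "subalgebra free_scale free_mult (free_algebra Y)"
  unfolding free_algebra_eq_generated by (rule free.subalgebra_generated)

lemma free_algebra_diff:
  assumes "p \<in> free_algebra Y" "q \<in> free_algebra Y"
  shows "p - q \<in> free_algebra Y"
  using subalgebra_free_algebra assms unfolding subalgebra_def by (blast intro: free.subspace_diff)

lemma free_algebra_mult: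
  assumes "p \<in> free_algebra Y" "q \<in> free_algebra Y"
  shows "free_mult p q \<in> free_algebra Y"
  using subalgebra_free_algebra assms unfolding subalgebra_def by blast

lemma (in nonassoc_algebra) free_lift_image:
  "free_lift (\<lambda>y. y) ` free_algebra Y = generated_subalgebra scale mult Y"
  unfolding free_algebra_eq_generated
  by (subst algebra_hom_image_generated[OF free.nonassoc_algebra_axioms
        nonassoc_algebra_axioms free_lift_hom]) (simp add: image_image)

text \<open>An isomorphism witnessing freeness agrees with evaluation, since homomorphisms are
  determined by their values on generators; so freeness can be tested on the kernel of evaluation.\<close>

lemma (in nonassoc_algebra) freely_generates_iff_kernel:
  "freely_generates scale mult Y
    \<longleftrightarrow> (\<forall>p\<in>free_algebra Y. free_lift (\<lambda>y. y) p = 0 \<longrightarrow> p = 0)"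
proof
  assume "freely_generates scale mult Y"
  then obtain \<phi> where hom: "algebra_hom_on (free_algebra Y) free_scale free_mult scale mult \<phi>"
    and inj: "inj_on \<phi> (free_algebra Y)"
    and gen: "\<And>y. y \<in> Y \<Longrightarrow> \<phi> (free_gen y) = y"
    unfolding freely_generates_def bij_betw_def by blast
  have eq: "\<phi> p = free_lift (\<lambda>y. y) p" if "p \<in> free_algebra Y" for p
  proof (rule algebra_hom_on_unique[OF free.nonassoc_algebra_axioms nonassoc_algebra_axioms])
    show "algebra_hom_on (generated_subalgebra free_scale free_mult (free_gen ` Y))
        free_scale free_mult scale mult \<phi>"
      using hom by (simp add: free_algebra_eq_generated)
    show "p \<in> generated_subalgebra free_scale free_mult (free_gen ` Y)"
      using that by (simp add: free_algebra_eq_generated)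
  qed (auto simp: gen free_lift_hom)
  have zero: "0 \<in> free_algebra Y" and "free_lift (\<lambda>y. y) 0 = 0"
    by (simp_all add: free_algebra_def free_lift_def)
  then show "\<forall>p\<in>free_algebra Y. free_lift (\<lambda>y. y) p = 0 \<longrightarrow> p = 0"
    using inj_onD[OF inj] eq by metis
next
  assume ker: "\<forall>p\<in>free_algebra Y. free_lift (\<lambda>y. y) p = 0 \<longrightarrow> p = 0"
  have "inj_on (free_lift (\<lambda>y. y)) (free_algebra Y)"
  proof (rule inj_onI)
    fix p q :: "'a word \<Rightarrow>\<^sub>0 'k"
    assume pq: "p \<in> free_algebra Y" "q \<in> free_algebra Y"
      "free_lift (\<lambda>y. y) p = free_lift (\<lambda>y. y) q"
    then have "free_lift (\<lambda>y. y) (p - q) = 0"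
      using free_lift_add[of "\<lambda>y. y" "p - q" q] by simp
    then show "p = q"
      using ker free_algebra_diff[OF pq(1,2)] by auto
  qed
  then show "freely_generates scale mult Y"
    unfolding freely_generates_def bij_betw_def
    by (intro exI[of _ "free_lift (\<lambda>y. y)"]) (simp add: free_lift_image free_lift_hom)
qed

context field_extension
begin

lemma embed_zero [simp]: "\<iota> 0 = 0"
  using embed_add[of 0 0] by (metis add_cancel_right_right add_0)

lemma embed_eq_zero_iff [simp]: "\<iota> x = 0 \<longleftrightarrow> x = 0"
proof
  assume "\<iota> x = 0"
  then have "\<iota> (x * inverse x) = 0" by (simp add: embed_mult)
  then show "x = 0" using embed_one by (cases "x = 0") auto
qed simp

lemma embed_diff: "\<iota> (x - y) = \<iota> x - \<iota> y"
  using embed_add[of "x - y" y] by (simp add: algebra_simps)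

definition extend_coeffs :: "('y word \<Rightarrow>\<^sub>0 'k) \<Rightarrow> ('y word \<Rightarrow>\<^sub>0 'f)"
  where "extend_coeffs q = Poly_Mapping.map \<iota> q"

lemma lookup_extend_coeffs [simp]:
  "Poly_Mapping.lookup (extend_coeffs q) w = \<iota> (Poly_Mapping.lookup q w)"
  by (simp add: extend_coeffs_def Poly_Mapping.map.rep_eq when_def)

lemma keys_extend_coeffs [simp]:
  "Poly_Mapping.keys (extend_coeffs q) = Poly_Mapping.keys q"
  by (auto simp: in_keys_iff)

lemma extend_coeffs_eq_zero_iff [simp]: "extend_coeffs q = 0 \<longleftrightarrow> q = 0"
  by (metis keys_extend_coeffs keys_eq_empty)

lemma extend_coeffs_diff: "extend_coeffs (p - q) = extend_coeffs p - extend_coeffs q"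
  by (rule poly_mapping_eqI) (simp add: lookup_minus embed_diff)

lemma extend_coeffs_mult:
  "extend_coeffs (free_mult p q) = free_mult (extend_coeffs p) (extend_coeffs q)"
  by (rule poly_mapping_eqI) (simp add: embed_mult split: word.split)

lemma restrict_scalars:
  assumes "nonassoc_algebra scale mult"
  shows "nonassoc_algebra (\<lambda>c. scale (\<iota> c)) mult"
proof -
  interpret A: nonassoc_algebra scale mult by fact
  have "vector_space (\<lambda>c. scale (\<iota> c))"
    by standard (simp_all add: embed_add embed_mult embed_one A.scale_right_distrib
        A.scale_left_distrib)
  then show ?thesis
    unfolding nonassoc_algebra_def nonassoc_algebra_axioms_def Vector_Spaces.linear_iff
    by (simp add: A.mult_simps)
qed

lemma free_lift_restrict_scalars:
  assumes "nonassoc_algebra scale mult"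
  shows "nonassoc_algebra.free_lift (\<lambda>c. scale (\<iota> c)) mult f q
    = nonassoc_algebra.free_lift scale mult f (extend_coeffs q)"
proof -
  interpret A: nonassoc_algebra scale mult by fact
  interpret R: nonassoc_algebra "\<lambda>c. scale (\<iota> c)" mult
    using assms by (rule restrict_scalars)
  have "R.eval_word f w = A.eval_word f w" for w
    by (induction w) simp_all
  then show ?thesis
    by (simp add: A.free_lift_def R.free_lift_def)
qed

text \<open>The induction removes one term at a time by taking the commutator with its \<open>K\<close>-rational
  factor. The coefficients \<open>c\<close> and the factors \<open>q\<close> must be arbitrary: the commutator keeps the
  coefficients but replaces every factor.\<close>

lemma ideal_avoiding_subfield_sum_zero:
  fixes I :: "('y word \<Rightarrow>\<^sub>0 'f) set" and q :: "'i \<Rightarrow> ('y word \<Rightarrow>\<^sub>0 'k)"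
  assumes I: "free.subspace I"
    and right: "\<And>p q. p \<in> I \<Longrightarrow> q \<in> free_algebra Y \<Longrightarrow> free_mult p (extend_coeffs q) \<in> I"
    and left: "\<And>p q. p \<in> I \<Longrightarrow> q \<in> free_algebra Y \<Longrightarrow> free_mult (extend_coeffs q) p \<in> I"
    and avoid: "\<And>q. q \<in> free_algebra Y \<Longrightarrow> extend_coeffs q \<in> I \<Longrightarrow> q = 0"
    and "finite J" and "\<And>j. j \<in> J \<Longrightarrow> q j \<in> free_algebra Y"
    and "(\<Sum>j\<in>J. free_scale (c j) (extend_coeffs (q j))) \<in> I"
  shows "(\<Sum>j\<in>J. free_scale (c j) (extend_coeffs (q j))) = 0"
  using assms(5-7)
proof (induction J arbitrary: q rule: finite_induct)
  case (insert j J)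
  let ?a = "extend_coeffs (q j)"
  define r where "r = (\<Sum>i\<in>J. free_scale (c i) (extend_coeffs (q i)))"
  define p where "p = free_scale (c j) ?a + r"
  have p_sum: "p = (\<Sum>i\<in>insert j J. free_scale (c i) (extend_coeffs (q i)))"
    using insert.hyps by (simp add: p_def r_def)
  have pI: "p \<in> I" using insert.prems(2) by (simp only: p_sum)
  have qY: "q j \<in> free_algebra Y" using insert.prems(1) by simp
  have "p = 0"
  proof (cases "q j = 0")
    case True
    then have "?a = 0" by simp
    then have "p = r" by (simp add: p_def)
    then show ?thesis
      using insert.IH[of q] insert.prems(1) pI by (simp add: r_def)
  next
    case False
    have "free_mult p ?a - free_mult ?a p = free_mult r ?a - free_mult ?a r"
      by (simp add: p_def free.mult_simps)
    also have "\<dots> = (\<Sum>i\<in>J. free_scale (c i)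
        (extend_coeffs (free_mult (q i) (q j) - free_mult (q j) (q i))))"
      by (simp add: r_def free.mult_sum_left free.mult_sum_right free.mult_simps
          sum_subtractf extend_coeffs_diff extend_coeffs_mult free.scale_right_diff_distrib)
    finally have comm: "free_mult p ?a - free_mult ?a p = \<dots>" .
    have "free_mult p ?a - free_mult ?a p \<in> I"
      using I right[OF pI qY] left[OF pI qY] by (rule free.subspace_diff)
    then have "free_mult p ?a - free_mult ?a p = 0"
      unfolding comm using insert.prems(1)
      by (intro insert.IH) (auto intro: free_algebra_diff free_algebra_mult)
    then have "free_mult p ?a = free_mult ?a p" by simp
    then obtain d where d: "p = free_scale d ?a"
      using False by (elim free_commute_proportional) simp
    show ?thesis
    proof (rule ccontr)
      assume "p \<noteq> 0"
      then have "d \<noteq> 0" using d by auto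
      then have "?a = free_scale (inverse d) p" by (simp add: d)
      also have "\<dots> \<in> I" using I pI by (rule free.subspace_scale)
      finally show False using avoid[OF qY] False by simp
    qed
  qed
  then show ?case by (simp only: p_sum)
qed simp

lemma ideal_avoiding_subfield_zero:
  fixes I :: "('y word \<Rightarrow>\<^sub>0 'f) set"
  assumes I: "free.subspace I"
    and right: "\<And>p q. p \<in> I \<Longrightarrow> q \<in> free_algebra Y \<Longrightarrow> free_mult p (extend_coeffs q) \<in> I"
    and left: "\<And>p q. p \<in> I \<Longrightarrow> q \<in> free_algebra Y \<Longrightarrow> free_mult (extend_coeffs q) p \<in> I"
    and avoid: "\<And>q. q \<in> free_algebra Y \<Longrightarrow> extend_coeffs q \<in> I \<Longrightarrow> q = 0"
    and p: "p \<in> I" "p \<in> free_algebra Y"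
  shows "p = 0"
proof -
  \<comment> \<open>Words have coefficients in \<open>K\<close>, so the expansion of \<open>p\<close> in the basis of words has the required form.\<close>
  have sum: "p = (\<Sum>w\<in>Poly_Mapping.keys p.
      free_scale (Poly_Mapping.lookup p w) (extend_coeffs (Poly_Mapping.single w 1)))"
    by (rule poly_mapping_eqI)
      (simp add: lookup_sum lookup_single when_def if_distrib in_keys_iff embed_one cong: if_cong)
  also have "\<dots> = 0"
  proof (rule ideal_avoiding_subfield_sum_zero[OF I right left avoid])
    show "Poly_Mapping.single w 1 \<in> free_algebra Y" if "w \<in> Poly_Mapping.keys p" for w
      using p(2) that by (auto simp: free_algebra_def)
  qed (use p(1) sum in simp_all)
  finally show ?thesis .
qed

end

theorem theorem2p2:
  fixes \<iota> :: "'k::field \<Rightarrow> 'f::field"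
    and scale :: "'f \<Rightarrow> 'a::ab_group_add \<Rightarrow> 'a"
    and mult :: "'a \<Rightarrow> 'a \<Rightarrow> 'a"
    and Y :: "'a set"
  assumes "field_extension \<iota>"
    and "nonassoc_algebra scale mult"
    and "finite Y" and "card Y \<ge> 2"
    and "freely_generates (\<lambda>c. scale (\<iota> c)) mult Y"
  shows "freely_generates scale mult Y"
proof -
  interpret field_extension \<iota> by fact
  interpret A: nonassoc_algebra scale mult by fact
  interpret R: nonassoc_algebra "\<lambda>c. scale (\<iota> c)" mult
    by (rule restrict_scalars) fact
  let ?ev = "A.free_lift (\<lambda>y. y)"
  let ?I = "{p. ?ev p = 0}"
  have mult_zero: "mult 0 x = 0" "mult x 0 = 0" for x
    using A.mult_simps(2)[of 0 0 x] A.mult_simps(4)[of x 0 0] by simp_all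
  have "free.subspace ?I"
    by (rule free.subspaceI)
      (simp_all add: A.free_lift_def[of _ 0] A.free_lift_add A.free_lift_scale)
  moreover have "free_mult p (extend_coeffs q) \<in> ?I" "free_mult (extend_coeffs q) p \<in> ?I"
    if "p \<in> ?I" for p and q :: "'a word \<Rightarrow>\<^sub>0 'k"
    using that by (simp_all add: A.free_lift_mult mult_zero)
  moreover have "q = 0" if "q \<in> free_algebra Y" "extend_coeffs q \<in> ?I" for q
    using assms(5) that unfolding R.freely_generates_iff_kernel
    by (simp add: free_lift_restrict_scalars[OF assms(2)])
  ultimately have "p = 0" if "p \<in> ?I" "p \<in> free_algebra Y" for p
    using that by (rule ideal_avoiding_subfield_zero)
  then show ?thesis
    unfolding A.freely_generates_iff_kernel by simp
qed

end
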